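(* Let $K$ be an algebraically closed field of characteristic $0$, $G$ a finite abelian group, and let $\Gamma\colon A=\bigoplus_{g\in G}A_g$ be a regular $G$-grading on a $K$-algebra $A$ with bicharacter $\beta$. Then $A$ admits a regular grading $\Gamma_0\colon A=\bigoplus_{h\in H}A'_h$ by a finite abelian group $H$, which is a coarsening of $\Gamma$, such that the regular decomposition of $A$ with respect to $\Gamma_0$ is minimal, and whose bicharacter $\theta$ is determined by $\beta$ (that is, $\theta(h,h')=\beta(g,g')$ whenever $g,g'\in G$, $h,h'\in H$, $A_g\subseteq A'_h$ and $A_{g'}\subseteq A'_{h'}$).
   Context: Algebras are associative. Abelian groups are written additively. A $G$-grading on $A$ is a decomposition $A=\bigoplus_{g\in G}A_g$ into subspaces with $A_gA_h\subseteq A_{g+h}$. A $G$-grading is regular if (i) for every $n\in\mathbb N$ and $(g_1,\dots,g_n)\in G^n$ there exist $a_i\in A_{g_i}$ with $a_1\cdots a_n\neq 0$; and (ii) for every $g,h\in G$ there is a scalar $\beta(g,h)\in K^*$, depending only on $g$ and $h$, such that $a_ga_h=\beta(g,h)a_ha_g$ for all $a_g\in A_g$, $a_h\in A_h$. The function $\beta\colon G\times G\to K^*$ is called the bicharacter of the grading; it satisfies $\beta(g,h)=\beta(h,g)^{-1}$ and is multiplicative in each argument. The regular decomposition is minimal if there are no $g\neq h$ in $G$ such that $\beta(g,x)=\beta(h,x)$ for all $x\in G$. A grading $\Gamma'\colon A=\bigoplus_{h\in H}A'_h$ is a coarsening of $\Gamma\colon A=\bigoplus_{g\in G}A_g$ if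 for every $g\in G$ there is $h\in H$ with $A_g\subseteq A'_h$. *)

theory Defs
  imports
    "HOL-Algebra.Coset"
    "HOL-Computational_Algebra.Computational_Algebra"
begin

text \<open>
  Algebras are associative but need not be unital, so the ring structure is the type class
  \<open>ring\<close> (which has no unit).
\<close>

locale assoc_algebra = vector_space scale
  for scale :: "'k::field \<Rightarrow> 'a::ring \<Rightarrow> 'a"  (infixr \<open>*s\<close> 75) +
  assumes scale_mult_left: "(c *s x) * y = c *s (x * y)"
    and scale_mult_right: "x * (c *s y) = c *s (x * y)"

text \<open>
  The grading group is an abelian group in the sense of HOL-Algebra, hence written
  multiplicatively. Only the values of the family of components on \<open>carrier G\<close> matter. The
  group may be infinite, so the direct sum condition asks for a unique finitely supported
  family of homogeneous components; the clause on indices outside the carrier makes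
  uniqueness of the total function \<open>f\<close> meaningful.
\<close>

locale graded_algebra = assoc_algebra scale + grp: comm_group G
  for scale :: "'k::field \<Rightarrow> 'a::ring \<Rightarrow> 'a"  (infixr \<open>*s\<close> 75)
    and G :: "('g, 'm) monoid_scheme"  (structure) +
  fixes A :: "'g \<Rightarrow> 'a set"
  assumes subspace_component: "g \<in> carrier G \<Longrightarrow> subspace (A g)"
    and direct_sum:
      "\<exists>!f. (\<forall>g\<in>carrier G. f g \<in> A g) \<and> (\<forall>g. g \<notin> carrier G \<longrightarrow> f g = 0) \<and>
            finite {g. f g \<noteq> 0} \<and> x = (\<Sum>g | f g \<noteq> 0. f g)"
    and component_mult:
      "\<lbrakk>g \<in> carrier G; h \<in> carrier G; a \<in> A g; b \<in> A h\<rbrakk> \<Longrightarrow> a * b \<in> A (g \<otimes> h)"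

text \<open>
  In \<open>nonvanishing\<close>, \<open>foldl (*) a as\<close> is the product of the nonempty list \<open>a # as\<close>;
  \<open>prod_list\<close> is not available without a unit.
\<close>

locale regular_grading = graded_algebra scale G A
  for scale :: "'k::field \<Rightarrow> 'a::ring \<Rightarrow> 'a"  (infixr \<open>*s\<close> 75)
    and G :: "('g, 'm) monoid_scheme"  (structure)
    and A :: "'g \<Rightarrow> 'a set" +
  fixes \<beta> :: "'g \<Rightarrow> 'g \<Rightarrow> 'k"
  assumes nonvanishing:
      "set (g # gs) \<subseteq> carrier G \<Longrightarrow>
        \<exists>a as. list_all2 (\<lambda>h b. b \<in> A h) (g # gs) (a # as) \<and> foldl (*) a as \<noteq> 0"
    and bichar_nonzero: "\<lbrakk>g \<in> carrier G; h \<in> carrier G\<rbrakk> \<Longrightarrow> \<beta> g h \<noteq> 0"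
    and commutation:
      "\<lbrakk>g \<in> carrier G; h \<in> carrier G; a \<in> A g; b \<in> A h\<rbrakk> \<Longrightarrow> a * b = \<beta> g h *s (b * a)"

definition minimal_bichar :: "('g, 'm) monoid_scheme \<Rightarrow> ('g \<Rightarrow> 'g \<Rightarrow> 'k) \<Rightarrow> bool" where
  "minimal_bichar G \<beta> \<longleftrightarrow>
    \<not> (\<exists>g\<in>carrier G. \<exists>h\<in>carrier G. g \<noteq> h \<and> (\<forall>x\<in>carrier G. \<beta> g x = \<beta> h x))"

definition is_coarsening ::
    "('h, 'n) monoid_scheme \<Rightarrow> ('h \<Rightarrow> 'a set) \<Rightarrow>
     ('g, 'm) monoid_scheme \<Rightarrow> ('g \<Rightarrow> 'a set) \<Rightarrow> bool" where
  "is_coarsening H A' G A \<longleftrightarrow> (\<forall>g\<in>carrier G. \<exists>h\<in>carrier H. A g \<subseteq> A' h)"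

end

theory Submission
  imports Defs
begin

text \<open>
  Let \<open>N\<close> be the radical of \<open>\<beta>\<close>, that is, the set of all \<open>n\<close> with \<open>\<beta> n x = 1\<close> for every \<open>x\<close>.
  Regularity makes \<open>\<beta>\<close> multiplicative and skew-symmetric, because both identities can be read
  off from a single nonzero product of homogeneous elements. Hence \<open>N\<close> is a subgroup and \<open>\<beta>\<close>
  factors through a form \<open>\<theta>\<close> on \<open>G Mod N\<close>, whose radical is trivial; this triviality is
  exactly minimality.

  It remains to merge the components over each coset \<open>C\<close> into \<open>\<Sum>g\<in>C. A g\<close>. For any subgroup
  of a finite abelian group this is again a grading, by the quotient group (lemma
  \<open>graded_algebra_coset_component\<close>). The merged grading has the commutation property
  because \<open>\<beta>\<close> is constant on pairs of cosets, and it inherits nonzero products from coset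
  representatives. Since the components \<open>A g\<close> are nonzero and independent, \<open>A g\<close> can lie in
  the component of a coset only if \<open>g\<close> belongs to it, so \<open>\<theta>\<close> is determined by \<open>\<beta>\<close>.
\<close>

section \<open>Merging the components of a grading over cosets\<close>

context graded_algebra
begin

definition coset_component :: "'g set \<Rightarrow> 'a set" where
  "coset_component C = {\<Sum>g\<in>C. f g | f. \<forall>g\<in>C. f g \<in> A g}"

lemma coset_componentI: "(\<And>g. g \<in> C \<Longrightarrow> f g \<in> A g) \<Longrightarrow> (\<Sum>g\<in>C. f g) \<in> coset_component C"
  unfolding coset_component_def by blast

lemma coset_componentE:
  assumes "x \<in> coset_component C"
  obtains f where "\<And>g. g \<in> C \<Longrightarrow> f g \<in> A g" "x = (\<Sum>g\<in>C. f g)"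
  using assms unfolding coset_component_def by blast

lemma subspace_coset_component:
  assumes "C \<subseteq> carrier G"
  shows "subspace (coset_component C)"
proof (rule subspaceI)
  show "0 \<in> coset_component C"
    using coset_componentI[of C "\<lambda>_. 0"] assms subspace_0 subspace_component by auto
next
  fix x y assume "x \<in> coset_component C" "y \<in> coset_component C"
  then obtain e f where "\<And>g. g \<in> C \<Longrightarrow> e g \<in> A g" "x = sum e C"
    "\<And>g. g \<in> C \<Longrightarrow> f g \<in> A g" "y = sum f C"
    by (metis coset_componentE)
  then show "x + y \<in> coset_component C"
    using coset_componentI[of C "\<lambda>g. e g + f g"] assms
    by (simp add: sum.distrib subset_iff subspace_add[OF subspace_component])
next
  fix c x assume "x \<in> coset_component C"
  then obtain e where "\<And>g. g \<in> C \<Longrightarrow> e g \<in> A g" "x = sum e C"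
    by (metis coset_componentE)
  then show "c *s x \<in> coset_component C"
    using coset_componentI[of C "\<lambda>g. c *s e g"] assms
    by (simp add: scale_sum_right subset_iff subspace_scale[OF subspace_component])
qed

lemma component_subset_coset_component:
  assumes "C \<subseteq> carrier G" "finite C" "g \<in> C"
  shows "A g \<subseteq> coset_component C"
proof
  fix a assume "a \<in> A g"
  then have "(\<Sum>h\<in>C. if h = g then a else 0) \<in> coset_component C"
    using assms(1) subspace_0 subspace_component by (intro coset_componentI) auto
  then show "a \<in> coset_component C"
    using assms by (simp add: sum.delta)
qed

lemma finite_direct_sum:
  assumes "finite (carrier G)"
  shows "\<exists>f. (\<forall>g\<in>carrier G. f g \<in> A g) \<and> x = (\<Sum>g\<in>carrier G. f g)"
proof -
  obtain f where f: "\<forall>g\<in>carrier G. f g \<in> A g" "\<forall>g. g \<notin> carrier G \<longrightarrow> f g = 0"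
    "x = (\<Sum>g | f g \<noteq> 0. f g)"
    using direct_sum[of x] by auto
  have "(\<Sum>g | f g \<noteq> 0. f g) = (\<Sum>g\<in>carrier G. f g)"
    using f(2) assms by (intro sum.mono_neutral_left) auto
  then show ?thesis
    using f by auto
qed

lemma components_independent:
  assumes fin: "finite (carrier G)"
    and e: "\<And>g. g \<in> carrier G \<Longrightarrow> e g \<in> A g"
    and f: "\<And>g. g \<in> carrier G \<Longrightarrow> f g \<in> A g"
    and eq: "(\<Sum>g\<in>carrier G. e g) = (\<Sum>g\<in>carrier G. f g)"
    and g: "g \<in> carrier G"
  shows "e g = f g"
proof -
  \<comment> \<open>Uniqueness in the direct sum concerns total functions, so families are extended by 0.\<close>
  define ext where "ext u = (\<lambda>h. if h \<in> carrier G then u h else 0)" for u :: "'g \<Rightarrow> 'a"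
  let ?P = "\<lambda>u. (\<forall>g\<in>carrier G. u g \<in> A g) \<and> (\<forall>g. g \<notin> carrier G \<longrightarrow> u g = 0) \<and>
    finite {g. u g \<noteq> 0} \<and> (\<Sum>g\<in>carrier G. e g) = (\<Sum>g | u g \<noteq> 0. u g)"
  have P: "?P (ext u)"
    if "\<And>g. g \<in> carrier G \<Longrightarrow> u g \<in> A g" "(\<Sum>g\<in>carrier G. u g) = (\<Sum>g\<in>carrier G. e g)" for u
  proof -
    have sub: "{g. ext u g \<noteq> 0} \<subseteq> carrier G"
      by (auto simp: ext_def)
    then have "(\<Sum>g | ext u g \<noteq> 0. ext u g) = (\<Sum>g\<in>carrier G. ext u g)"
      using fin by (intro sum.mono_neutral_left) auto
    also have "\<dots> = (\<Sum>g\<in>carrier G. u g)"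
      by (simp add: ext_def)
    finally show ?thesis
      using that sub fin finite_subset by (auto simp: ext_def)
  qed
  have "ext e = ext f"
  proof (rule ex1E[OF direct_sum[of "\<Sum>g\<in>carrier G. e g"]])
    fix u assume "\<forall>v. ?P v \<longrightarrow> v = u"
    then have "ext e = u" "ext f = u"
      using P[OF e refl] P[OF f eq[symmetric]] by blast+
    then show ?thesis
      by simp
  qed
  then have "ext e g = ext f g"
    by simp
  then show ?thesis
    using g by (simp add: ext_def)
qed

text \<open>
  If \<open>g\<close> were outside \<open>C\<close>, the element \<open>a\<close> would have two different decompositions: one
  concentrated in degree \<open>g\<close> and one with support in \<open>C\<close>.
\<close>

lemma component_subset_coset_componentD:
  assumes fin: "finite (carrier G)" and C: "C \<subseteq> carrier G" and g: "g \<in> carrier G"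
    and sub: "A g \<subseteq> coset_component C" and a: "a \<in> A g" "a \<noteq> 0"
  shows "g \<in> C"
proof (rule ccontr)
  assume "g \<notin> C"
  obtain f where f: "\<And>h. h \<in> C \<Longrightarrow> f h \<in> A h" "a = (\<Sum>h\<in>C. f h)"
    using a sub by (metis coset_componentE subsetD)
  have "(\<Sum>h\<in>carrier G. if h \<in> C then f h else 0) = a"
    using f(2) C fin by (simp add: sum.inter_restrict[symmetric] Int_absorb1)
  moreover have "(\<Sum>h\<in>carrier G. if h = g then a else 0) = a"
    using fin g by simp
  ultimately have "(if g = g then a else 0) = (if g \<in> C then f g else 0)"
    using f(1) a(1) g C subspace_0 subspace_component
    by (intro components_independent[OF fin, of "\<lambda>h. if h = g then a else 0"
          "\<lambda>h. if h \<in> C then f h else 0"]) auto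
  then show False
    using \<open>g \<notin> C\<close> a by simp
qed

lemma sum_rcosets:
  fixes f :: "'g \<Rightarrow> 'a"
  assumes "finite (carrier G)" "subgroup N G"
  shows "(\<Sum>C\<in>rcosets N. \<Sum>g\<in>C. f g) = (\<Sum>g\<in>carrier G. f g)"
proof -
  have "(\<Sum>g\<in>\<Union>(rcosets N). f g) = (\<Sum>C\<in>rcosets N. \<Sum>g\<in>C. f g)"
  proof -
    have "\<forall>C\<in>rcosets N. finite C"
      using grp.rcosets_subset_PowG[OF assms(2)] finite_subset[OF _ assms(1)] by blast
    then show ?thesis
      using grp.rcos_disjoint[OF assms(2)]
      by (subst sum.Union_disjoint) (auto simp: pairwise_def disjnt_def)
  qed
  then show ?thesis
    by (simp add: grp.rcosets_part_G[OF assms(2)])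
qed

text \<open>
  A family of components over the cosets refines to a family of components over \<open>G\<close>, because
  each element of \<open>G\<close> lies in exactly one coset. So uniqueness over the cosets follows from
  uniqueness over \<open>G\<close>.
\<close>

lemma graded_algebra_coset_component:
  assumes fin: "finite (carrier G)" and N: "subgroup N G"
  shows "graded_algebra scale (G Mod N) coset_component"
proof -
  interpret normal N G
    using N grp.normal_iff_subgroup by blast
  have coset_subset: "C \<subseteq> carrier G" if "C \<in> rcosets N" for C
    using that grp.rcosets_subset_PowG[OF N] by blast
  have fin_rcosets: "finite (rcosets N)"
    using grp.rcosets_subset_PowG[OF N] fin by (simp add: finite_subset)
  interpret Q: comm_group "G Mod N"
    using grp.abelian_FactGroup N by blast
  have coset_eq: "C = D" if "C \<in> rcosets N" "D \<in> rcosets N" "g \<in> C" "g \<in> D" for C D g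
    using that grp.rcos_disjoint[OF N] by (auto simp: pairwise_def disjnt_def)
  show ?thesis
  proof unfold_locales
    fix C assume "C \<in> carrier (G Mod N)"
    then show "subspace (coset_component C)"
      using coset_subset subspace_coset_component by (simp add: FactGroup_def)
  next
    fix x
    obtain f where f: "\<forall>g\<in>carrier G. f g \<in> A g" "x = (\<Sum>g\<in>carrier G. f g)"
      using finite_direct_sum[OF fin] by blast
    define F where "F C = (if C \<in> rcosets N then \<Sum>g\<in>C. f g else 0)" for C
    have sum_support: "(\<Sum>C | E C \<noteq> 0. E C) = (\<Sum>C\<in>rcosets N. E C)" "finite {C. E C \<noteq> 0}"
      if "\<forall>C. C \<notin> rcosets N \<longrightarrow> E C = 0" for E :: "'g set \<Rightarrow> 'a"
    proof -
      have "{C. E C \<noteq> 0} \<subseteq> rcosets N"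
        using that by auto
      then show "(\<Sum>C | E C \<noteq> 0. E C) = (\<Sum>C\<in>rcosets N. E C)" "finite {C. E C \<noteq> 0}"
        using fin_rcosets finite_subset by (auto intro!: sum.mono_neutral_left)
    qed
    show "\<exists>!f. (\<forall>g\<in>carrier (G Mod N). f g \<in> coset_component g) \<and>
              (\<forall>g. g \<notin> carrier (G Mod N) \<longrightarrow> f g = 0) \<and>
              finite {g. f g \<noteq> 0} \<and> x = (\<Sum>g | f g \<noteq> 0. f g)"
    proof (rule ex1I[of _ F], goal_cases)
      case 1
      have "F C \<in> coset_component C" if "C \<in> rcosets N" for C
        using that f(1) coset_subset[OF that] by (auto simp: F_def intro!: coset_componentI)
      moreover have "(\<Sum>C\<in>rcosets N. F C) = x"
        using sum_rcosets[OF fin N, of f] f(2) by (simp add: F_def)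
      ultimately show ?case
        using sum_support[of F] by (auto simp: F_def FactGroup_def)
    next
      case (2 E)
      then have E: "\<And>C. C \<in> rcosets N \<Longrightarrow> E C \<in> coset_component C"
        "\<forall>C. C \<notin> rcosets N \<longrightarrow> E C = 0" "x = (\<Sum>C | E C \<noteq> 0. E C)"
        by (auto simp: FactGroup_def)
      have "\<forall>C\<in>rcosets N. \<exists>e. (\<forall>g\<in>C. e g \<in> A g) \<and> E C = (\<Sum>g\<in>C. e g)"
        using E(1) by (metis coset_componentE)
      then obtain e where e: "\<And>C g. C \<in> rcosets N \<Longrightarrow> g \<in> C \<Longrightarrow> e C g \<in> A g"
        "\<And>C. C \<in> rcosets N \<Longrightarrow> E C = (\<Sum>g\<in>C. e C g)"
        by metis
      \<comment> \<open>The refinement of \<open>E\<close> to a single family over \<open>G\<close>.\<close>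
      define e' where "e' g = e (N #> g) g" for g
      have e'_eq: "e' g = e C g" if "C \<in> rcosets N" "g \<in> C" for C g
      proof -
        have "g \<in> carrier G"
          using that coset_subset by blast
        then show ?thesis
          using coset_eq[OF that(1) _ that(2), of "N #> g"] grp.rcosetsI[of N g] grp.rcos_self[OF _ N]
            subset by (simp add: e'_def)
      qed
      have E_eq: "E C = (\<Sum>g\<in>C. e' g)" if "C \<in> rcosets N" for C
        using e(2)[OF that] e'_eq[OF that] by simp
      have "x = (\<Sum>C\<in>rcosets N. E C)"
        using E(2,3) sum_support(1) by metis
      also have "\<dots> = (\<Sum>g\<in>carrier G. e' g)"
        using sum_rcosets[OF fin N, of e'] E_eq by simp
      finally have "(\<Sum>g\<in>carrier G. e' g) = (\<Sum>g\<in>carrier G. f g)"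
        using f(2) by simp
      moreover have "e' g \<in> A g" if "g \<in> carrier G" for g
        using e(1) that grp.rcosetsI[of N g] grp.rcos_self[OF that N] subset by (simp add: e'_def)
      ultimately have "e' g = f g" if "g \<in> carrier G" for g
        using components_independent[OF fin, of e' f] f(1) that by blast
      then have "E C = (\<Sum>g\<in>C. f g)" if "C \<in> rcosets N" for C
        using E_eq[OF that] coset_subset[OF that] by (auto intro!: sum.cong)
      then show "E = F"
        using E(2) by (auto simp: F_def)
    qed
  next
    fix C D x y
    assume "C \<in> carrier (G Mod N)" "D \<in> carrier (G Mod N)"
      and x: "x \<in> coset_component C" and y: "y \<in> coset_component D"
    then have C: "C \<in> rcosets N" and D: "D \<in> rcosets N"
      by (auto simp: FactGroup_def)
    have CD: "C <#> D \<in> rcosets N"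
      using setmult_closed[OF C D] .
    have sub: "A g \<subseteq> coset_component (C <#> D)" if "g \<in> C <#> D" for g
      using component_subset_coset_component[OF coset_subset[OF CD] _ that]
        finite_subset[OF coset_subset[OF CD] fin] by blast
    obtain a b where a: "\<And>g. g \<in> C \<Longrightarrow> a g \<in> A g" "x = (\<Sum>g\<in>C. a g)"
      and b: "\<And>g. g \<in> D \<Longrightarrow> b g \<in> A g" "y = (\<Sum>g\<in>D. b g)"
      using x y by (metis coset_componentE)
    have "a g * b h \<in> coset_component (C <#> D)" if "g \<in> C" "h \<in> D" for g h
    proof -
      have "a g * b h \<in> A (g \<otimes> h)"
        using that a b coset_subset[OF C] coset_subset[OF D] component_mult by blast
      moreover have "g \<otimes> h \<in> C <#> D"
        using that unfolding set_mult_def by blast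
      ultimately show ?thesis
        using sub by blast
    qed
    then show "x * y \<in> coset_component (C \<otimes>\<^bsub>G Mod N\<^esub> D)"
      using subspace_coset_component[OF coset_subset[OF CD]]
      by (auto simp: a(2) b(2) sum_product FactGroup_def intro!: subspace_sum)
  qed
qed

end

section \<open>The bicharacter and its radical\<close>

context regular_grading
begin

lemma bichar_mult_swap:
  assumes "g \<in> carrier G" "h \<in> carrier G"
  shows "\<beta> g h * \<beta> h g = 1"
proof -
  obtain a b where ab: "a \<in> A g" "b \<in> A h" "a * b \<noteq> 0"
    using nonvanishing[of g "[h]"] assms by (auto simp: list_all2_Cons1)
  have "1 *s (a * b) = (\<beta> g h * \<beta> h g) *s (a * b)"
    using commutation[of g h a b] commutation[of h g b a] assms ab by simp
  then show ?thesis
    using ab(3) scale_right_imp_eq by metis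
qed

text \<open>
  Commuting \<open>c\<close> past \<open>a * b\<close> in one step or in two steps produces two scalar multiples of the
  same element \<open>c * a * b\<close>, which can be chosen nonzero.
\<close>

lemma bichar_mult_left:
  assumes "g \<in> carrier G" "h \<in> carrier G" "x \<in> carrier G"
  shows "\<beta> (g \<otimes> h) x = \<beta> g x * \<beta> h x"
proof -
  obtain c a b where abc: "c \<in> A x" "a \<in> A g" "b \<in> A h" "c * a * b \<noteq> 0"
    using nonvanishing[of x "[g, h]"] assms by (auto simp: list_all2_Cons1)
  have "\<beta> (g \<otimes> h) x *s (c * a * b) = a * b * c"
    using commutation[of "g \<otimes> h" x "a * b" c] component_mult assms abc by (simp add: mult.assoc)
  also have "\<dots> = a * (\<beta> h x *s (c * b))"
    using commutation[of h x b c] assms abc by (simp add: mult.assoc)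
  also have "\<dots> = \<beta> h x *s ((a * c) * b)"
    by (simp add: scale_mult_right mult.assoc)
  also have "\<dots> = \<beta> h x *s ((\<beta> g x *s (c * a)) * b)"
    using commutation[of g x a c] assms abc by simp
  also have "\<dots> = (\<beta> g x * \<beta> h x) *s (c * a * b)"
    by (simp add: scale_mult_left mult.commute)
  finally show ?thesis
    using abc(4) scale_right_imp_eq by metis
qed

lemma bichar_one_left:
  assumes "x \<in> carrier G"
  shows "\<beta> \<one> x = 1"
  using bichar_mult_left[of \<one> \<one> x] bichar_nonzero[of \<one> x] assms by simp

lemma bichar_inv_left:
  assumes "g \<in> carrier G" "x \<in> carrier G"
  shows "\<beta> g x * \<beta> (inv g) x = 1"
  using bichar_mult_left[of g "inv g" x] bichar_one_left[of x] assms by simp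

definition radical :: "'g set" where
  "radical = {n \<in> carrier G. \<forall>x\<in>carrier G. \<beta> n x = 1}"

lemma subgroup_radical: "subgroup radical G"
proof (rule grp.subgroupI)
  show "radical \<noteq> {}"
    using bichar_one_left unfolding radical_def by blast
next
  fix g assume "g \<in> radical"
  then show "inv g \<in> radical"
    using bichar_inv_left[of g] by (auto simp: radical_def)
qed (auto simp: radical_def bichar_mult_left)

text \<open>
  This equivalence is used in both directions: from left to right it makes the form on the
  quotient well defined, from right to left it makes that form minimal.
\<close>

lemma rcoset_radical_eq_iff:
  assumes "g \<in> carrier G" "h \<in> carrier G"
  shows "radical #> g = radical #> h \<longleftrightarrow> (\<forall>x\<in>carrier G. \<beta> g x = \<beta> h x)"
proof
  assume "radical #> g = radical #> h"
  then have "g \<in> radical #> h"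
    using grp.rcos_self[OF assms(1) subgroup_radical] by simp
  then obtain n where "n \<in> radical" "g = n \<otimes> h"
    unfolding r_coset_def by blast
  then show "\<forall>x\<in>carrier G. \<beta> g x = \<beta> h x"
    using assms by (auto simp: radical_def bichar_mult_left)
next
  assume eq: "\<forall>x\<in>carrier G. \<beta> g x = \<beta> h x"
  then have "g \<otimes> inv h \<in> radical"
    using assms bichar_inv_left[of h] by (simp add: radical_def bichar_mult_left)
  then have "(g \<otimes> inv h) \<otimes> h \<in> radical #> h"
    unfolding r_coset_def by blast
  then have "g \<in> radical #> h"
    using assms by (simp add: grp.m_assoc)
  then show "radical #> g = radical #> h"
    using grp.repr_independence assms subgroup_radical by metis
qed

definition quotient_bichar :: "'g set \<Rightarrow> 'g set \<Rightarrow> 'k" where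
  "quotient_bichar C D = \<beta> (SOME g. g \<in> C) (SOME h. h \<in> D)"

lemma quotient_bichar_eq:
  assumes C: "C \<in> rcosets radical" and D: "D \<in> rcosets radical" and g: "g \<in> C" and h: "h \<in> D"
  shows "quotient_bichar C D = \<beta> g h"
proof -
  have cong: "u \<in> carrier G" "v \<in> carrier G" "\<forall>x\<in>carrier G. \<beta> u x = \<beta> v x"
    if "E \<in> rcosets radical" "u \<in> E" "v \<in> E" for E u v
  proof -
    obtain w where w: "w \<in> carrier G" "E = radical #> w"
      using \<open>E \<in> rcosets radical\<close> unfolding RCOSETS_def by blast
    show uv: "u \<in> carrier G" "v \<in> carrier G"
      using that grp.rcosets_subset_PowG[OF subgroup_radical] by blast+
    have "radical #> u = radical #> v"
      using grp.repr_independence[OF _ w(1) subgroup_radical] that w(2) by simp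
    then show "\<forall>x\<in>carrier G. \<beta> u x = \<beta> v x"
      using rcoset_radical_eq_iff[OF uv] by simp
  qed
  define u v where "u = (SOME g. g \<in> C)" and "v = (SOME h. h \<in> D)"
  have u: "u \<in> C" and v: "v \<in> D"
    using someI[of "\<lambda>x. x \<in> C" g] someI[of "\<lambda>x. x \<in> D" h] g h by (simp_all add: u_def v_def)
  have "\<beta> u v = \<beta> g v"
    using cong[OF C u g] cong[OF D v h] by blast
  \<comment> \<open>The radical is defined by the first argument; skew-symmetry covers the second.\<close>
  also have "\<dots> = \<beta> g h"
  proof -
    have "\<beta> v g = \<beta> h g" "\<beta> g v * \<beta> v g = 1" "\<beta> g h * \<beta> h g = 1"
      using cong[OF C u g] cong[OF D v h] bichar_mult_swap by blast+
    then show ?thesis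
      by (metis mult_cancel_right mult_zero_right zero_neq_one)
  qed
  finally show ?thesis
    by (simp add: quotient_bichar_def u_def v_def)
qed

section \<open>The minimal regular coarsening\<close>

lemma regular_grading_quotient:
  assumes fin: "finite (carrier G)"
  shows "regular_grading scale (G Mod radical) coset_component quotient_bichar"
proof -
  interpret Q: graded_algebra scale "G Mod radical" coset_component
    using graded_algebra_coset_component[OF fin subgroup_radical] .
  have coset_subset: "C \<subseteq> carrier G" if "C \<in> rcosets radical" for C
    using that grp.rcosets_subset_PowG[OF subgroup_radical] by blast
  have coset_nonempty: "\<exists>g. g \<in> C" if "C \<in> rcosets radical" for C
    using that grp.rcos_self[OF _ subgroup_radical] unfolding RCOSETS_def by blast
  show ?thesis
  proof unfold_locales
    fix C Cs assume Cs: "set (C # Cs) \<subseteq> carrier (G Mod radical)"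
    define rep where "rep D = (SOME g. g \<in> D)" for D :: "'g set"
    have rep: "rep D \<in> D" "D \<subseteq> carrier G" if "D \<in> set (C # Cs)" for D
      using that Cs coset_nonempty[of D] coset_subset[of D] someI_ex[of "\<lambda>g. g \<in> D"]
      unfolding rep_def FactGroup_def by auto
    have "rep D \<in> carrier G" if "D \<in> set (C # Cs)" for D
      using rep[OF that] by blast
    then have "set (map rep (C # Cs)) \<subseteq> carrier G"
      by auto
    then obtain a as where "list_all2 (\<lambda>g b. b \<in> A g) (map rep (C # Cs)) (a # as)"
      and nz: "foldl (*) a as \<noteq> 0"
      using nonvanishing[of "rep C" "map rep Cs"] by auto
    then have "list_all2 (\<lambda>D b. b \<in> A (rep D)) (C # Cs) (a # as)"
      by (simp only: list_all2_map1)
    then have "list_all2 (\<lambda>D b. b \<in> coset_component D) (C # Cs) (a # as)"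
    proof (rule list.rel_mono_strong)
      fix D b assume "D \<in> set (C # Cs)" and b: "b \<in> A (rep D)"
      then have D: "D \<subseteq> carrier G" "rep D \<in> D"
        using rep by blast+
      then show "b \<in> coset_component D"
        using component_subset_coset_component[OF D(1) finite_subset[OF D(1) fin] D(2)] b by blast
    qed
    then show "\<exists>a as. list_all2 (\<lambda>D b. b \<in> coset_component D) (C # Cs) (a # as) \<and>
        foldl (*) a as \<noteq> 0"
      using nz by blast
  next
    fix C D assume "C \<in> carrier (G Mod radical)" "D \<in> carrier (G Mod radical)"
    then have CD: "C \<in> rcosets radical" "D \<in> rcosets radical"
      by (auto simp: FactGroup_def)
    then obtain g h where gh: "g \<in> C" "h \<in> D"
      using coset_nonempty by blast
    then show "quotient_bichar C D \<noteq> 0"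
      using quotient_bichar_eq[OF CD gh] bichar_nonzero[of g h] CD coset_subset by auto
  next
    fix C D x y
    assume "C \<in> carrier (G Mod radical)" "D \<in> carrier (G Mod radical)"
      and x: "x \<in> coset_component C" and y: "y \<in> coset_component D"
    then have CD: "C \<in> rcosets radical" "D \<in> rcosets radical"
      by (auto simp: FactGroup_def)
    obtain a b where a: "\<And>g. g \<in> C \<Longrightarrow> a g \<in> A g" "x = (\<Sum>g\<in>C. a g)"
      and b: "\<And>g. g \<in> D \<Longrightarrow> b g \<in> A g" "y = (\<Sum>g\<in>D. b g)"
      using x y by (metis coset_componentE)
    \<comment> \<open>All homogeneous summands commute up to the same scalar, which can be pulled out.\<close>
    have "a g * b h = quotient_bichar C D *s (b h * a g)" if "g \<in> C" "h \<in> D" for g h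
      using commutation[of g h "a g" "b h"] quotient_bichar_eq[OF CD that] that a(1) b(1)
        coset_subset[OF CD(1)] coset_subset[OF CD(2)] by auto
    then have "x * y = (\<Sum>g\<in>C. \<Sum>h\<in>D. quotient_bichar C D *s (b h * a g))"
      by (simp add: a(2) b(2) sum_product)
    also have "\<dots> = quotient_bichar C D *s (\<Sum>h\<in>D. \<Sum>g\<in>C. b h * a g)"
      by (subst sum.swap) (simp add: scale_sum_right)
    finally show "x * y = quotient_bichar C D *s (y * x)"
      by (simp add: a(2) b(2) sum_product)
  qed
qed

lemma minimal_quotient_bichar: "minimal_bichar (G Mod radical) quotient_bichar"
  unfolding minimal_bichar_def
proof (rule notI, elim bexE conjE)
  fix C D
  assume "C \<in> carrier (G Mod radical)" "D \<in> carrier (G Mod radical)" "C \<noteq> D"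
    and eq: "\<forall>X\<in>carrier (G Mod radical). quotient_bichar C X = quotient_bichar D X"
  then obtain g h where g: "g \<in> carrier G" "C = radical #> g" and h: "h \<in> carrier G" "D = radical #> h"
    unfolding FactGroup_def RCOSETS_def by auto
  have self: "radical #> x \<in> rcosets radical" "x \<in> radical #> x" if "x \<in> carrier G" for x
    using that grp.rcosetsI subgroup.subset[OF subgroup_radical] grp.rcos_self[OF _ subgroup_radical] by blast+
  have "\<beta> g x = \<beta> h x" if "x \<in> carrier G" for x
  proof -
    have "quotient_bichar C (radical #> x) = quotient_bichar D (radical #> x)"
      using eq self[OF that] by (simp add: FactGroup_def)
    then show ?thesis
      using quotient_bichar_eq[OF self(1)[OF g(1)] self(1)[OF that] self(2)[OF g(1)] self(2)[OF that]]
        quotient_bichar_eq[OF self(1)[OF h(1)] self(1)[OF that] self(2)[OF h(1)] self(2)[OF that]]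
        g h by simp
  qed
  then show False
    using rcoset_radical_eq_iff g h \<open>C \<noteq> D\<close> by blast
qed

end

theorem proposition10:
  fixes scale :: "'k::{alg_closed_field, field_char_0} \<Rightarrow> 'a::ring \<Rightarrow> 'a"
    and G :: "('g, 'm) monoid_scheme"
    and A :: "'g \<Rightarrow> 'a set"
    and \<beta> :: "'g \<Rightarrow> 'g \<Rightarrow> 'k"
  assumes "finite (carrier G)"
    and "regular_grading scale G A \<beta>"
  shows "\<exists>(H :: 'g set monoid) (A' :: 'g set \<Rightarrow> 'a set) (\<theta> :: 'g set \<Rightarrow> 'g set \<Rightarrow> 'k).
           finite (carrier H) \<and>
           regular_grading scale H A' \<theta> \<and>
           is_coarsening H A' G A \<and>
           minimal_bichar H \<theta> \<and>
           (\<forall>g\<in>carrier G. \<forall>g'\<in>carrier G. \<forall>h\<in>carrier H. \<forall>h'\<in>carrier H.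
              A g \<subseteq> A' h \<and> A g' \<subseteq> A' h' \<longrightarrow> \<theta> h h' = \<beta> g g')"
proof -
  interpret regular_grading scale G A \<beta>
    using assms(2) .
  have coset_subset: "C \<subseteq> carrier G" if "C \<in> rcosets\<^bsub>G\<^esub> radical" for C
    using that grp.rcosets_subset_PowG[OF subgroup_radical] by blast
  have carrier_eq: "carrier (G Mod radical) = rcosets\<^bsub>G\<^esub> radical"
    by (simp add: FactGroup_def)
  have mem: "g \<in> C"
    if g: "g \<in> carrier G" and C: "C \<in> rcosets\<^bsub>G\<^esub> radical" "A g \<subseteq> coset_component C" for g C
  proof -
    obtain a where "a \<in> A g" "a \<noteq> 0"
      using nonvanishing[of g "[]"] g by (auto simp: list_all2_Cons1)
    then show ?thesis
      using component_subset_coset_componentD[OF assms(1) coset_subset] g C by blast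
  qed
  have "finite (carrier (G Mod radical))"
    unfolding carrier_eq using grp.rcosets_subset_PowG[OF subgroup_radical] assms(1)
    by (simp add: finite_subset)
  moreover have "is_coarsening (G Mod radical) coset_component G A"
    unfolding is_coarsening_def carrier_eq
  proof
    fix g assume g: "g \<in> carrier G"
    have C: "radical #>\<^bsub>G\<^esub> g \<in> rcosets\<^bsub>G\<^esub> radical" "g \<in> radical #>\<^bsub>G\<^esub> g"
      using g grp.rcosetsI subgroup.subset[OF subgroup_radical] grp.rcos_self[OF _ subgroup_radical]
      by blast+
    then show "\<exists>C\<in>rcosets\<^bsub>G\<^esub> radical. A g \<subseteq> coset_component C"
      using component_subset_coset_component[OF coset_subset[OF C(1)] _ C(2)]
        finite_subset[OF coset_subset[OF C(1)] assms(1)] by blast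
  qed
  moreover have "\<forall>g\<in>carrier G. \<forall>g'\<in>carrier G.
      \<forall>h\<in>carrier (G Mod radical). \<forall>h'\<in>carrier (G Mod radical).
        A g \<subseteq> coset_component h \<and> A g' \<subseteq> coset_component h' \<longrightarrow> quotient_bichar h h' = \<beta> g g'"
    unfolding carrier_eq by (intro ballI impI, elim conjE) (rule quotient_bichar_eq; simp add: mem)
  ultimately show ?thesis
    using regular_grading_quotient[OF assms(1)] minimal_quotient_bichar by blast
qed

end
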